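(* Let $\Bbbk$ be a field, let $q\in\{-1,1\}$ and $\alpha\in\Bbbk$ with $\alpha\neq0$, and let $\mathbb{K}$ be the $\Bbbk$-algebra generated by $y_1,y_2,x_1,x_2$ subject to the relations $$x_2x_1=q\,x_1x_2,\quad y_2y_1=-y_1y_2,\quad y_1x_1=x_1y_1,\quad y_1x_2=x_2y_2,\quad y_2x_1=x_1y_2,\quad y_2x_2=\alpha x_2y_1.$$ Let $S\subset\Bbbk\{y_1,y_2,x_1,x_2\}$ be the set consisting of the six polynomials $$x_2x_1-q\,x_1x_2,\quad y_2y_1+y_1y_2,\quad x_1y_1-y_1x_1,\quad x_2y_2-y_1x_2,\quad x_1y_2-y_2x_1,\quad x_2y_1-\tfrac1\alpha y_2x_2.$$ Then, with respect to the degree lexicographic order with $y_1\prec y_2\prec x_1\prec x_2$, the set $S$ is a Gröbner-Shirshov basis of the ideal $\mathrm{Id}(S)$, which is the ideal of defining relations of $\mathbb{K}$, i.e. $\mathbb{K}=\Bbbk\{y_1,y_2,x_1,x_2\}/\mathrm{Id}(S)$.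
   Context: Let $X=\{y_1,y_2,x_1,x_2\}$, let $X^*$ be the free monoid of words in $X$, and let $\Bbbk\{X\}$ be the free associative unital $\Bbbk$-algebra on $X$ (noncommutative polynomials). $\mathrm{Id}(S)$ denotes the two-sided ideal of $\Bbbk\{X\}$ generated by $S$. The degree lexicographic order $\prec$ on $X^*$ compares words first by length and then, for equal length, lexicographically from left to right with $y_1\prec y_2\prec x_1\prec x_2$. For a nonzero $f\in\Bbbk\{X\}$, $\overline{f}$ denotes its leading (i.e. $\prec$-largest) word; $f$ is monic if the coefficient of $\overline{f}$ is $1$. For monic $f,g$: (i) if $w=\overline{f}a=b\overline{g}$ with $a,b\in X^*$ and $|\overline{f}|+|\overline{g}|>|w|$, then $(f,g)_w:=fa-bg$ is the intersection composition; (ii) if $w=\overline{f}=a\overline{g}b$ with $a,b\in X^*$, then $(f,g)_w:=f-agb$ is the inclusion composition. A composition $(f,g)_w$ is trivial modulo $S$ if $(f,g)_w=\sum_i\alpha_i a_is_ib_i$ (finite sum) with $\alpha_i\in\Bbbk$, $a_i,b_i\in X^*$, $s_i\in S$ and $a_i\overline{s_i}b_i\prec w$ for all $i$. A nonempty set $S$ of monic polynomials is a Gröbner-Shirshov basis of $\mathrm{Id}(S)$ if every composition $(f,g)_w$ with $f,g\in S$ is trivial modulo $S$. *)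

theory Defs
  imports
    "HOL-Library.Poly_Mapping"
    "HOL-Algebra.QuotRing"
    "HOL-Algebra.Module"
begin

section \<open>Words and the degree lexicographic order\<close>

text \<open>The library's convolution product on finitely supported functions
  is taken over an additive monoid, so concatenation of words is written \<open>+\<close>
  and the empty word \<open>0\<close>.\<close>

datatype 'x free_monoid = Word (letters: "'x list")

instantiation free_monoid :: (type) monoid_add
begin
definition zero_free_monoid :: "'a free_monoid"
  where "0 = Word []"
definition plus_free_monoid :: "'a free_monoid \<Rightarrow> 'a free_monoid \<Rightarrow> 'a free_monoid"
  where "u + v = Word (letters u @ letters v)"
instance
  by standard (simp_all add: zero_free_monoid_def plus_free_monoid_def)
end

definition wlength :: "'x free_monoid \<Rightarrow> nat"
  where "wlength u = length (letters u)"

instantiation free_monoid :: (linorder) linorder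
begin
definition less_free_monoid :: "'a free_monoid \<Rightarrow> 'a free_monoid \<Rightarrow> bool"
  where "u < v \<longleftrightarrow> (letters u, letters v) \<in> lenlex {(a, b). a < b}"
definition less_eq_free_monoid :: "'a free_monoid \<Rightarrow> 'a free_monoid \<Rightarrow> bool"
  where "u \<le> v \<longleftrightarrow> u < v \<or> u = (v :: 'a free_monoid)"
instance
proof
  fix u v w :: "'a free_monoid"
  have tr: "trans (lenlex {(a, b). a < (b :: 'a)})"
    by (rule lenlex_transI) (auto simp: trans_def)
  have irr: "(xs, xs) \<notin> lenlex {(a, b). a < (b :: 'a)}" for xs
    by (rule lenlex_irreflexive) auto
  have asym: False if "u < v" "v < u" for u v :: "'a free_monoid"
    using that irr transD[OF tr] unfolding less_free_monoid_def by blast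
  show "u \<le> u" by (simp add: less_eq_free_monoid_def)
  show "u \<le> w" if "u \<le> v" "v \<le> w"
    using that transD[OF tr] by (auto simp: less_eq_free_monoid_def less_free_monoid_def)
  show "u = v" if "u \<le> v" "v \<le> u"
    using that asym by (auto simp: less_eq_free_monoid_def)
  show "u < v \<longleftrightarrow> u \<le> v \<and> \<not> v \<le> u"
    using asym by (auto simp: less_eq_free_monoid_def)
  have "total (lenlex {(a, b). a < (b :: 'a)})"
    by (rule total_lenlex) (auto simp: total_on_def)
  then show "u \<le> v \<or> v \<le> u"
    by (auto simp: total_on_def less_eq_free_monoid_def less_free_monoid_def
        intro: free_monoid.expand)
qed
end


section \<open>Noncommutative polynomials\<close>

text \<open>The free associative algebra is the monoid algebra of the free monoid;
  addition, convolution product and unit are those of the library.\<close>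

type_synonym ('x, 'k) nc_poly = "'x free_monoid \<Rightarrow>\<^sub>0 'k"

definition mon :: "'x free_monoid \<Rightarrow> ('x, 'k :: field) nc_poly"
  where "mon u = Poly_Mapping.single u 1"

definition var :: "'x \<Rightarrow> ('x, 'k :: field) nc_poly"
  where "var x = mon (Word [x])"

definition scale :: "'k :: field \<Rightarrow> ('x, 'k) nc_poly \<Rightarrow> ('x, 'k) nc_poly"
  where "scale c p = Poly_Mapping.map (\<lambda>d. c * d) p"

text \<open>Specified for nonzero polynomials only.\<close>

definition lead_word :: "('x :: linorder, 'k :: field) nc_poly \<Rightarrow> 'x free_monoid"
  where "lead_word f = Max (Poly_Mapping.keys f)"

definition monic :: "('x :: linorder, 'k :: field) nc_poly \<Rightarrow> bool"
  where "monic f \<longleftrightarrow> f \<noteq> 0 \<and> Poly_Mapping.lookup f (lead_word f) = 1"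


section \<open>Algebras as records, ideals, quotients and presentations\<close>

text \<open>The record type of modules has a ring multiplication besides \<open>smult\<close>, so it serves
  for \<open>'k\<close>-algebras. The ideals of HOL-Algebra are two-sided; for unital
  algebras they coincide with the algebra ideals.\<close>

definition free_algebra :: "('k :: field, ('x, 'k) nc_poly) module"
  where "free_algebra =
    \<lparr>carrier = UNIV, mult = (*), one = 1, zero = 0, add = (+), smult = scale\<rparr>"

lemma free_algebra_ring: "ring (free_algebra :: ('k :: field, ('x, 'k) nc_poly) module)"
proof (rule ringI)
  show "abelian_group (free_algebra :: ('k, ('x, 'k) nc_poly) module)"
    by (rule abelian_groupI)
      (auto simp: free_algebra_def algebra_simps intro: exI[of _ "- x" for x])
  show "Group.monoid (free_algebra :: ('k, ('x, 'k) nc_poly) module)"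
    by (rule monoidI) (simp_all add: free_algebra_def mult.assoc)
qed (simp_all add: free_algebra_def algebra_simps)

abbreviation nc_Id :: "('x, 'k :: field) nc_poly set \<Rightarrow> ('x, 'k) nc_poly set"
  where "nc_Id S \<equiv> genideal free_algebra S"

text \<open>On cosets, \<open>c (p + I) = c p + I\<close> is computed as \<open>I + c (p + I)\<close>.\<close>

definition quotient_algebra ::
    "('k, 'a) module \<Rightarrow> 'a set \<Rightarrow> ('k, 'a set) module"
  where "quotient_algebra A I =
    ring.extend (A Quot I)
      (module.fields (\<lambda>c P. I <+>\<^bsub>A\<^esub> (\<lambda>p. c \<odot>\<^bsub>A\<^esub> p) ` P))"

text \<open>A set of relations \<open>l = r\<close> is a set of pairs \<open>(l, r)\<close>.\<close>

definition relation_ideal ::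
    "(('x, 'k :: field) nc_poly \<times> ('x, 'k) nc_poly) set \<Rightarrow> ('x, 'k) nc_poly set"
  where "relation_ideal R = nc_Id {l - r | l r. (l, r) \<in> R}"

definition presented_algebra ::
    "(('x, 'k :: field) nc_poly \<times> ('x, 'k) nc_poly) set \<Rightarrow> ('k, ('x, 'k) nc_poly set) module"
  where "presented_algebra R = quotient_algebra free_algebra (relation_ideal R)"


section \<open>Groebner--Shirshov bases\<close>

definition trivial_mod ::
    "('x :: linorder, 'k :: field) nc_poly set \<Rightarrow> 'x free_monoid \<Rightarrow> ('x, 'k) nc_poly \<Rightarrow> bool"
  where "trivial_mod S w h \<longleftrightarrow>
    (\<exists>(n :: nat) c a s b.
       (\<forall>i<n. s i \<in> S \<and> a i + lead_word (s i) + b i < w) \<and>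
       h = (\<Sum>i<n. scale (c i) (mon (a i) * s i * mon (b i))))"

definition gs_basis :: "('x :: linorder, 'k :: field) nc_poly set \<Rightarrow> bool"
  where "gs_basis S \<longleftrightarrow>
    S \<noteq> {} \<and> (\<forall>f\<in>S. monic f) \<and>
    (\<forall>f\<in>S. \<forall>g\<in>S. \<forall>w a b.
       (w = lead_word f + a \<and> w = b + lead_word g \<and>
        wlength (lead_word f) + wlength (lead_word g) > wlength w \<longrightarrow>
          trivial_mod S w (f * mon a - mon b * g)) \<and>
       (w = lead_word f \<and> w = a + lead_word g + b \<longrightarrow>
          trivial_mod S w (f - mon a * g * mon b)))"


section \<open>The algebra and the set of polynomials\<close>

datatype letter = Y1 | Y2 | X1 | X2

primrec rank :: "letter \<Rightarrow> nat"
  where "rank Y1 = 0" | "rank Y2 = 1" | "rank X1 = 2" | "rank X2 = 3"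

instantiation letter :: linorder
begin
definition less_letter :: "letter \<Rightarrow> letter \<Rightarrow> bool"
  where "a < b \<longleftrightarrow> rank a < rank b"
definition less_eq_letter :: "letter \<Rightarrow> letter \<Rightarrow> bool"
  where "a \<le> b \<longleftrightarrow> rank a \<le> rank b"
instance
proof
  show "a = b" if "a \<le> b" "b \<le> a" for a b :: letter
    using that by (cases a; cases b) (simp_all add: less_eq_letter_def)
qed (auto simp: less_letter_def less_eq_letter_def)
end

definition K_relations ::
    "'k :: field \<Rightarrow> 'k \<Rightarrow> ((letter, 'k) nc_poly \<times> (letter, 'k) nc_poly) set"
  where "K_relations q \<alpha> =
    {(var X2 * var X1, scale q (var X1 * var X2)),
     (var Y2 * var Y1, - (var Y1 * var Y2)),
     (var Y1 * var X1, var X1 * var Y1),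
     (var Y1 * var X2, var X2 * var Y2),
     (var Y2 * var X1, var X1 * var Y2),
     (var Y2 * var X2, scale \<alpha> (var X2 * var Y1))}"

definition K_algebra :: "'k :: field \<Rightarrow> 'k \<Rightarrow> ('k, (letter, 'k) nc_poly set) module"
  where "K_algebra q \<alpha> = presented_algebra (K_relations q \<alpha>)"

definition K_gs_set :: "'k :: field \<Rightarrow> 'k \<Rightarrow> (letter, 'k) nc_poly set"
  where "K_gs_set q \<alpha> =
    {var X2 * var X1 - scale q (var X1 * var X2),
     var Y2 * var Y1 + var Y1 * var Y2,
     var X1 * var Y1 - var Y1 * var X1,
     var X2 * var Y2 - var Y1 * var X2,
     var X1 * var Y2 - var Y2 * var X1,
     var X2 * var Y1 - scale (1 / \<alpha>) (var Y2 * var X2)}"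

end

theory Submission
  imports Defs
begin

text \<open>
  Up to nonzero scalars the six polynomials are the differences of the two sides of the six
  relations, so both families generate the same ideal, and the claim about the quotient
  follows. The content is the Groebner--Shirshov property.

  Each of the six polynomials is a binomial \<open>u - c v\<close> with \<open>v < u\<close>, that is, a rewriting rule
  replacing \<open>u\<close> by \<open>c v\<close>, and the six words \<open>u\<close> are different and of length two. Hence the only
  compositions that are not identically zero come from words \<open>x y z\<close> of three letters in which
  \<open>x y\<close> and \<open>y z\<close> are both leading (\<open>quadratic_gs_basisI\<close>). There are four of them:
  \<open>X2 X1 Y1\<close>, \<open>X2 X1 Y2\<close>, \<open>X2 Y2 Y1\<close> and \<open>X1 Y2 Y1\<close>. In each case the two ways of applying a rule
  to \<open>x y z\<close> rewrite further to the same multiple of the same word. Equality up to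
  a polynomial that is trivial below \<open>x y z\<close> is a congruence containing all rewriting
  steps at smaller words (\<open>trivial_mod_rewrite\<close>), so these four compositions are trivial.
\<close>

section \<open>Triviality modulo a set\<close>

lemma scale_single [simp]: "scale c (Poly_Mapping.single u d) = Poly_Mapping.single u (c * d)"
  by (simp add: scale_def)

lemma lookup_scale [simp]: "Poly_Mapping.lookup (scale c p) u = c * Poly_Mapping.lookup p u"
  by (simp add: scale_def map.rep_eq when_def)

lemma scale_scale: "scale c (scale d p) = scale (c * d) p"
  by (rule poly_mapping_eqI) (simp add: algebra_simps)

lemma scale_sum: "scale c (\<Sum>i\<in>A. f i) = (\<Sum>i\<in>A. scale c (f i))"
  by (rule poly_mapping_eqI) (simp add: lookup_sum sum_distrib_left)

lemma trivial_mod_0: "trivial_mod S w 0"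
  unfolding trivial_mod_def by (rule exI[of _ 0]) simp

lemma trivial_mod_add_term:
  assumes "trivial_mod S w h" and "t \<in> S" and "u + lead_word t + v < w"
  shows "trivial_mod S w (h + scale d (mon u * t * mon v))"
proof -
  obtain n :: nat and c a s b where *:
    "\<forall>i<n. s i \<in> S \<and> a i + lead_word (s i) + b i < w"
    "h = (\<Sum>i<n. scale (c i) (mon (a i) * s i * mon (b i)))"
    using assms(1) unfolding trivial_mod_def by blast
  show ?thesis
    unfolding trivial_mod_def
    by (intro exI[of _ "Suc n"] exI[of _ "c(n := d)"] exI[of _ "a(n := u)"]
        exI[of _ "s(n := t)"] exI[of _ "b(n := v)"])
      (use * assms(2,3) in \<open>simp add: less_Suc_eq\<close>)
qed

lemma trivial_mod_add:
  assumes "trivial_mod S w h" and "trivial_mod S w h'"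
  shows "trivial_mod S w (h + h')"
proof -
  obtain n :: nat and c a s b where *:
    "\<forall>i<n. s i \<in> S \<and> a i + lead_word (s i) + b i < w"
    "h' = (\<Sum>i<n. scale (c i) (mon (a i) * s i * mon (b i)))"
    using assms(2) unfolding trivial_mod_def by blast
  have "trivial_mod S w (h + (\<Sum>i<m. scale (c i) (mon (a i) * s i * mon (b i))))" if "m \<le> n" for m
    using that
  proof (induction m)
    case 0
    then show ?case by (simp add: assms(1))
  next
    case (Suc m)
    then show ?case
      using trivial_mod_add_term[of S w _ "s m" "a m" "b m" "c m"] *(1)
      by (simp add: add.assoc[symmetric])
  qed
  then show ?thesis using *(2) by blast
qed

lemma trivial_mod_uminus:
  assumes "trivial_mod S w h"
  shows "trivial_mod S w (- h)"
proof -
  obtain n :: nat and c a s b where *: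
    "\<forall>i<n. s i \<in> S \<and> a i + lead_word (s i) + b i < w"
    "h = (\<Sum>i<n. scale (c i) (mon (a i) * s i * mon (b i)))"
    using assms unfolding trivial_mod_def by blast
  have "- h = scale (- 1) h"
    by (rule poly_mapping_eqI) simp
  then show ?thesis
    unfolding trivial_mod_def
    by (intro exI[of _ n] exI[of _ "\<lambda>i. - 1 * c i"] exI[of _ a] exI[of _ s] exI[of _ b])
      (use * in \<open>simp add: scale_sum scale_scale\<close>)
qed

lemma trivial_mod_diff_trans [trans]:
  assumes "trivial_mod S w (f - g)" and "trivial_mod S w (g - h)"
  shows "trivial_mod S w (f - h)"
  using trivial_mod_add[OF assms] by simp

lemma trivial_mod_diff_sym: "trivial_mod S w (f - g) \<Longrightarrow> trivial_mod S w (g - f)"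
  using trivial_mod_uminus[of S w "f - g"] by simp


section \<open>Binomials as rewriting rules\<close>

definition binomial :: "'x free_monoid \<Rightarrow> 'k :: field \<Rightarrow> 'x free_monoid \<Rightarrow> ('x, 'k) nc_poly"
  where "binomial u c v = Poly_Mapping.single u 1 - Poly_Mapping.single v c"

lemma lead_word_binomial:
  assumes "v < u"
  shows "lead_word (binomial u c v) = u"
  unfolding lead_word_def
proof (rule Max_eqI)
  show "x \<le> u" if "x \<in> Poly_Mapping.keys (binomial u c v)" for x
    using that assms
    by (auto simp: binomial_def in_keys_iff lookup_minus lookup_single when_def split: if_splits)
  show "u \<in> Poly_Mapping.keys (binomial u c v)"
    using assms by (auto simp: binomial_def in_keys_iff lookup_minus lookup_single when_def)
qed simp

lemma monic_binomial:
  assumes "v < u"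
  shows "monic (binomial u c v)"
proof -
  have "Poly_Mapping.lookup (binomial u c v) u = 1"
    using assms by (auto simp: binomial_def lookup_minus lookup_single when_def)
  then show ?thesis
    by (auto simp: monic_def lead_word_binomial[OF assms])
qed

text \<open>A multiple of \<open>a (u - c v) b\<close> is the difference between a term containing \<open>u\<close> and the result
  of replacing \<open>u\<close> by \<open>c v\<close> in it.\<close>

lemma trivial_mod_rewrite:
  assumes "binomial u c v \<in> S" and "v < u" and "a + u + b < w"
  shows "trivial_mod S w (Poly_Mapping.single (a + u + b) d - Poly_Mapping.single (a + v + b) (d * c))"
proof -
  have "scale d (mon a * binomial u c v * mon b)
      = Poly_Mapping.single (a + u + b) d - Poly_Mapping.single (a + v + b) (d * c)"
    by (rule poly_mapping_eqI)
      (simp add: binomial_def mon_def right_diff_distrib left_diff_distrib mult_single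
        lookup_minus lookup_single when_def)
  then show ?thesis
    using trivial_mod_add_term[OF trivial_mod_0 assms(1), of a b w d] assms
    by (simp add: lead_word_binomial)
qed


section \<open>Quadratic Groebner--Shirshov bases\<close>

lemma wlength_add: "wlength (u + v) = wlength u + wlength v"
  by (simp add: wlength_def plus_free_monoid_def)

lemma wlength_eq_0: "wlength u = 0 \<longleftrightarrow> u = 0"
  by (cases u) (simp add: wlength_def zero_free_monoid_def)

text \<open>An overlap of two words of length two is either total, which makes the two
  polynomials equal and the composition zero, or consists of one letter; an inclusion is total.\<close>

lemma quadratic_gs_basisI:
  assumes "S \<noteq> {}" and "\<And>f. f \<in> S \<Longrightarrow> monic f"
    and len: "\<And>f. f \<in> S \<Longrightarrow> wlength (lead_word f) = 2"
    and inj: "inj_on lead_word S"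
    and overlap: "\<And>f g x y z. f \<in> S \<Longrightarrow> g \<in> S \<Longrightarrow> lead_word f = Word [x, y] \<Longrightarrow>
      lead_word g = Word [y, z] \<Longrightarrow>
      trivial_mod S (Word [x, y, z]) (f * mon (Word [z]) - mon (Word [x]) * g)"
  shows "gs_basis S"
proof -
  have mon_0: "mon 0 = (1 :: ('a, 'b) nc_poly)"
    by (simp add: mon_def)
  have int: "trivial_mod S w (f * mon a - mon b * g)"
    if fg: "f \<in> S" "g \<in> S" and w: "w = lead_word f + a" "w = b + lead_word g"
      and short: "wlength (lead_word f) + wlength (lead_word g) > wlength w" for f g w a b
  proof -
    have "wlength w = 2 + wlength a" "wlength w = wlength b + 2"
      using w len[OF fg(1)] len[OF fg(2)] by (metis wlength_add)+
    then have ab: "wlength a = wlength b" "wlength a < 2"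
      using short len[OF fg(1)] len[OF fg(2)] by simp_all
    show ?thesis
    proof (cases "wlength a = 0")
      case True
      then have "a = 0" "b = 0" using ab by (simp_all flip: wlength_eq_0)
      moreover from this have "f = g" using w fg inj by (auto dest: inj_onD)
      ultimately show ?thesis by (simp add: mon_0 trivial_mod_0)
    next
      case False
      then have "wlength a = 1" "wlength b = 1" using ab by auto
      then obtain z x where zx: "a = Word [z]" "b = Word [x]"
        by (cases a; cases b) (auto simp: wlength_def length_Suc_conv)
      obtain p y where "lead_word f = Word [p, y]"
        using len[OF fg(1)] by (cases "lead_word f") (auto simp: wlength_def length_Suc_conv numeral_2_eq_2)
      moreover obtain y' z' where "lead_word g = Word [y', z']"
        using len[OF fg(2)] by (cases "lead_word g") (auto simp: wlength_def length_Suc_conv numeral_2_eq_2)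
      ultimately show ?thesis
        using w zx overlap[OF fg] by (auto simp: plus_free_monoid_def)
    qed
  qed
  have incl: "trivial_mod S w (f - mon a * g * mon b)"
    if fg: "f \<in> S" "g \<in> S" and w: "w = lead_word f" "w = a + lead_word g + b" for f g w a b
  proof -
    have "wlength a + 2 + wlength b = 2"
      using w len[OF fg(1)] len[OF fg(2)] by (metis wlength_add)
    then have "a = 0" "b = 0" by (simp_all add: wlength_eq_0)
    moreover from this have "f = g" using w fg inj by (auto dest: inj_onD)
    ultimately show ?thesis by (simp add: mon_0 trivial_mod_0)
  qed
  show ?thesis
    unfolding gs_basis_def
    by (intro conjI ballI allI impI; (elim conjE)?)
      (rule assms(1) | erule assms(2) | (rule int, assumption+) | (rule incl, assumption+))+
qed


section \<open>The six polynomials\<close>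

lemma K_gs_set_binomials:
  "K_gs_set q \<alpha> =
    {binomial (Word [X2, X1]) q (Word [X1, X2]),
     binomial (Word [Y2, Y1]) (-1) (Word [Y1, Y2]),
     binomial (Word [X1, Y1]) 1 (Word [Y1, X1]),
     binomial (Word [X2, Y2]) 1 (Word [Y1, X2]),
     binomial (Word [X1, Y2]) 1 (Word [Y2, X1]),
     binomial (Word [X2, Y1]) (1 / \<alpha>) (Word [Y2, X2])}"
  by (simp add: K_gs_set_def binomial_def var_def mon_def mult_single plus_free_monoid_def
      single_uminus)

lemmas word_order = less_free_monoid_def Cons_lenlex_iff less_letter_def

lemma gs_basis_K_gs_set:
  fixes q \<alpha> :: "'k :: field"
  shows "gs_basis (K_gs_set q \<alpha>)"
proof -
  define S where "S = K_gs_set q \<alpha>"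
  note S_iff = K_gs_set_binomials[of q \<alpha>, folded S_def, THEN eqset_imp_iff, unfolded insert_iff empty_iff]
  note lead = lead_word_binomial monic_binomial word_order
  have x2x1: "binomial (Word [X2, X1]) q (Word [X1, X2]) \<in> S"
    and y2y1: "binomial (Word [Y2, Y1]) (-1) (Word [Y1, Y2]) \<in> S"
    and x1y1: "binomial (Word [X1, Y1]) 1 (Word [Y1, X1]) \<in> S"
    and x2y2: "binomial (Word [X2, Y2]) 1 (Word [Y1, X2]) \<in> S"
    and x1y2: "binomial (Word [X1, Y2]) 1 (Word [Y2, X1]) \<in> S"
    and x2y1: "binomial (Word [X2, Y1]) (1 / \<alpha>) (Word [Y2, X2]) \<in> S"
    by (simp_all add: S_iff)
  let ?T = "\<lambda>w u d v e. trivial_mod S (Word w)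
    (Poly_Mapping.single (Word u) d - Poly_Mapping.single (Word v) e)"
  have step: "?T w (a @ u @ b) d (a @ v @ b) e"
    if "binomial (Word u) c (Word v) \<in> S" "Word v < Word u" "Word (a @ u @ b) < Word w" "e = d * c"
    for u v a b w c d e
    using trivial_mod_rewrite[OF that(1,2), of "Word a" "Word b" "Word w" d] that(3,4)
    by (simp add: plus_free_monoid_def)
  note step_back = step[THEN trivial_mod_diff_sym]
  \<comment> \<open>The two terms on the right are the results of the two ways of rewriting \<open>x y z\<close>.\<close>
  have overlap: "binomial (Word [x, y]) c (Word [v1, v2]) * mon (Word [z])
      - mon (Word [x]) * binomial (Word [y, z]) d (Word [w1, w2])
      = Poly_Mapping.single (Word [x, w1, w2]) d - Poly_Mapping.single (Word [v1, v2, z]) c"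
    for x y z v1 v2 w1 w2 :: letter and c d :: 'k
    by (simp add: binomial_def mon_def right_diff_distrib left_diff_distrib mult_single
        plus_free_monoid_def)
  \<comment> \<open>Rewriting steps lead from the first of these terms down to a common one and,
    read backwards, from there up to the second.\<close>
  have x2x1y1: "?T [X2, X1, Y1] [X2, Y1, X1] 1 [X1, X2, Y1] q"
  proof -
    have "?T [X2, X1, Y1] [X2, Y1, X1] 1 [Y2, X2, X1] (1 / \<alpha>)"
      using step[OF x2y1, of "[]" "[X1]" "[X2, X1, Y1]" "(1 / \<alpha>)" "1"] by (simp add: word_order)
    also have "?T [X2, X1, Y1] [Y2, X2, X1] (1 / \<alpha>) [Y2, X1, X2] (q / \<alpha>)"
      using step[OF x2x1, of "[Y2]" "[]" "[X2, X1, Y1]" "(q / \<alpha>)" "(1 / \<alpha>)"] by (simp add: word_order)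
    also have "?T [X2, X1, Y1] [Y2, X1, X2] (q / \<alpha>) [X1, Y2, X2] (q / \<alpha>)"
      using step_back[OF x1y2, of "[]" "[X2]" "[X2, X1, Y1]" "(q / \<alpha>)" "(q / \<alpha>)"] by (simp add: word_order)
    also have "?T [X2, X1, Y1] [X1, Y2, X2] (q / \<alpha>) [X1, X2, Y1] q"
      using step_back[OF x2y1, of "[X1]" "[]" "[X2, X1, Y1]" "(q / \<alpha>)" "q"] by (simp add: word_order)
    finally show ?thesis .
  qed
  have x2x1y2: "?T [X2, X1, Y2] [X2, Y2, X1] 1 [X1, X2, Y2] q"
  proof -
    have "?T [X2, X1, Y2] [X2, Y2, X1] 1 [Y1, X2, X1] 1"
      using step[OF x2y2, of "[]" "[X1]" "[X2, X1, Y2]" "1" "1"] by (simp add: word_order)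
    also have "?T [X2, X1, Y2] [Y1, X2, X1] 1 [Y1, X1, X2] q"
      using step[OF x2x1, of "[Y1]" "[]" "[X2, X1, Y2]" "q" "1"] by (simp add: word_order)
    also have "?T [X2, X1, Y2] [Y1, X1, X2] q [X1, Y1, X2] q"
      using step_back[OF x1y1, of "[]" "[X2]" "[X2, X1, Y2]" "q" "q"] by (simp add: word_order)
    also have "?T [X2, X1, Y2] [X1, Y1, X2] q [X1, X2, Y2] q"
      using step_back[OF x2y2, of "[X1]" "[]" "[X2, X1, Y2]" "q" "q"] by (simp add: word_order)
    finally show ?thesis .
  qed
  have x2y2y1: "?T [X2, Y2, Y1] [X2, Y1, Y2] (- 1) [Y1, X2, Y1] 1"
  proof -
    have "?T [X2, Y2, Y1] [X2, Y1, Y2] (- 1) [Y2, X2, Y2] (- 1 / \<alpha>)"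
      using step[OF x2y1, of "[]" "[Y2]" "[X2, Y2, Y1]" "(- 1 / \<alpha>)" "(- 1)"] by (simp add: word_order)
    also have "?T [X2, Y2, Y1] [Y2, X2, Y2] (- 1 / \<alpha>) [Y2, Y1, X2] (- 1 / \<alpha>)"
      using step[OF x2y2, of "[Y2]" "[]" "[X2, Y2, Y1]" "(- 1 / \<alpha>)" "(- 1 / \<alpha>)"] by (simp add: word_order)
    also have "?T [X2, Y2, Y1] [Y2, Y1, X2] (- 1 / \<alpha>) [Y1, Y2, X2] (1 / \<alpha>)"
      using step[OF y2y1, of "[]" "[X2]" "[X2, Y2, Y1]" "(1 / \<alpha>)" "(- 1 / \<alpha>)"] by (simp add: word_order)
    also have "?T [X2, Y2, Y1] [Y1, Y2, X2] (1 / \<alpha>) [Y1, X2, Y1] 1"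
      using step_back[OF x2y1, of "[Y1]" "[]" "[X2, Y2, Y1]" "(1 / \<alpha>)" "1"] by (simp add: word_order)
    finally show ?thesis .
  qed
  have x1y2y1: "?T [X1, Y2, Y1] [X1, Y1, Y2] (- 1) [Y2, X1, Y1] 1"
  proof -
    have "?T [X1, Y2, Y1] [X1, Y1, Y2] (- 1) [Y1, X1, Y2] (- 1)"
      using step[OF x1y1, of "[]" "[Y2]" "[X1, Y2, Y1]" "(- 1)" "(- 1)"] by (simp add: word_order)
    also have "?T [X1, Y2, Y1] [Y1, X1, Y2] (- 1) [Y1, Y2, X1] (- 1)"
      using step[OF x1y2, of "[Y1]" "[]" "[X1, Y2, Y1]" "(- 1)" "(- 1)"] by (simp add: word_order)
    also have "?T [X1, Y2, Y1] [Y1, Y2, X1] (- 1) [Y2, Y1, X1] 1"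
      using step_back[OF y2y1, of "[]" "[X1]" "[X1, Y2, Y1]" "(- 1)" "1"] by (simp add: word_order)
    also have "?T [X1, Y2, Y1] [Y2, Y1, X1] 1 [Y2, X1, Y1] 1"
      using step_back[OF x1y1, of "[Y2]" "[]" "[X1, Y2, Y1]" "1" "1"] by (simp add: word_order)
    finally show ?thesis .
  qed
  have "gs_basis S"
  proof (rule quadratic_gs_basisI)
    show "S \<noteq> {}" by (simp add: S_def K_gs_set_binomials)
    show "monic f" if "f \<in> S" for f
      using that by (auto simp: S_iff lead)
    show "wlength (lead_word f) = 2" if "f \<in> S" for f
      using that by (auto simp: S_iff lead wlength_def)
    show "inj_on lead_word S"
      by (auto simp: inj_on_def S_iff lead)
    show "trivial_mod S (Word [x, y, z]) (f * mon (Word [z]) - mon (Word [x]) * g)"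
      if "f \<in> S" "g \<in> S" "lead_word f = Word [x, y]" "lead_word g = Word [y, z]"
      for f g x y z
      using that by (auto simp: S_iff lead overlap x2x1y1 x2x1y2 x2y2y1 x1y2y1)
  qed
  then show ?thesis by (simp add: S_def)
qed


section \<open>The ideal of the relations\<close>

text \<open>Ideals of a unital algebra absorb scalars, which are multiples of the unit.\<close>

lemma nc_Id_subset:
  fixes A B :: "('x, 'k :: field) nc_poly set"
  assumes "\<And>p. p \<in> A \<Longrightarrow> \<exists>c. \<exists>r\<in>B. p = scale c r"
  shows "nc_Id A \<subseteq> nc_Id B"
proof (rule ring.genideal_minimal[OF free_algebra_ring])
  have B: "B \<subseteq> carrier free_algebra" by (simp add: free_algebra_def)
  show I: "ideal (nc_Id B) free_algebra"
    using B by (rule ring.genideal_ideal[OF free_algebra_ring])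
  have "scale c r \<in> nc_Id B" if "r \<in> B" for c r
  proof -
    have "scale c r = Poly_Mapping.single 0 c * r"
      unfolding scale_def by (rule mult_map_scale_conv_mult)
    then show ?thesis
      using ideal.I_l_closed[OF I, of r "Poly_Mapping.single 0 c"] that
        ring.genideal_self[OF free_algebra_ring B]
      by (auto simp: free_algebra_def)
  qed
  then show "A \<subseteq> nc_Id B" using assms by blast
qed

lemma nc_Id_K_gs_set:
  fixes q \<alpha> :: "'k :: field"
  assumes "\<alpha> \<noteq> 0"
  shows "nc_Id (K_gs_set q \<alpha>) = relation_ideal (K_relations q \<alpha>)"
proof -
  let ?D = "{l - r | l r. (l, r) \<in> K_relations q \<alpha>}"
  have scale_1: "p = scale 1 p" and scale_m1: "r - p = scale (- 1) (p - r)" for p r :: "(letter, 'k) nc_poly"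
    by (rule poly_mapping_eqI; simp add: lookup_minus)+
  have scale_y2x2: "p - scale \<alpha> r = scale (- \<alpha>) (r - scale (1 / \<alpha>) p)"
    "r - scale (1 / \<alpha>) p = scale (- 1 / \<alpha>) (p - scale \<alpha> r)" for p r :: "(letter, 'k) nc_poly"
    by (rule poly_mapping_eqI; simp add: assms lookup_minus algebra_simps)+
  note multiples =
    scale_1[of "var X2 * var X1 - scale q (var X1 * var X2)"]
    scale_1[of "var Y2 * var Y1 + var Y1 * var Y2"]
    scale_m1[of "var X1 * var Y1" "var Y1 * var X1"] scale_m1[of "var Y1 * var X1" "var X1 * var Y1"]
    scale_m1[of "var X2 * var Y2" "var Y1 * var X2"] scale_m1[of "var Y1 * var X2" "var X2 * var Y2"]
    scale_m1[of "var X1 * var Y2" "var Y2 * var X1"] scale_m1[of "var Y2 * var X1" "var X1 * var Y2"]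
    scale_y2x2(1)[of "var Y2 * var X2" "var X2 * var Y1"]
    scale_y2x2(2)[of "var X2 * var Y1" "var Y2 * var X2"]
  have D: "?D = {var X2 * var X1 - scale q (var X1 * var X2),
     var Y2 * var Y1 + var Y1 * var Y2,
     var Y1 * var X1 - var X1 * var Y1,
     var Y1 * var X2 - var X2 * var Y2,
     var Y2 * var X1 - var X1 * var Y2,
     var Y2 * var X2 - scale \<alpha> (var X2 * var Y1)}"
    (is "_ = ?E")
  proof -
    have "?D = (\<lambda>(l, r). l - r) ` K_relations q \<alpha>" by force
    also have "\<dots> = ?E" by (simp add: K_relations_def)
    finally show ?thesis .
  qed
  have "nc_Id (K_gs_set q \<alpha>) \<subseteq> nc_Id ?D"
  proof (rule nc_Id_subset)
    show "\<exists>c. \<exists>r\<in>?D. p = scale c r" if "p \<in> K_gs_set q \<alpha>" for p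
      using that multiples unfolding K_gs_set_def D by fast
  qed
  moreover have "nc_Id ?D \<subseteq> nc_Id (K_gs_set q \<alpha>)"
  proof (rule nc_Id_subset)
    show "\<exists>c. \<exists>r\<in>K_gs_set q \<alpha>. p = scale c r" if "p \<in> ?D" for p
      using that multiples unfolding K_gs_set_def D by fast
  qed
  ultimately show ?thesis by (simp add: relation_ideal_def)
qed

theorem mainTheorem6:
  fixes q \<alpha> :: "'k :: field"
  assumes "q \<in> {-1, 1}" and "\<alpha> \<noteq> 0"
  shows "gs_basis (K_gs_set q \<alpha>) \<and>
    nc_Id (K_gs_set q \<alpha>) = relation_ideal (K_relations q \<alpha>) \<and>
    K_algebra q \<alpha> = quotient_algebra free_algebra (nc_Id (K_gs_set q \<alpha>))"
  using gs_basis_K_gs_set[of q \<alpha>] nc_Id_K_gs_set[OF assms(2), of q]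
  by (simp add: K_algebra_def presented_algebra_def)

end
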